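(* Let $p\ge q$, $\mathbf a\in(0,\infty)^p$, $\mathbf b\in(0,\infty)^q$. Suppose there is a measurable function $g_0:\mathbb R\to[0,\infty)$ such that $$\frac{\Gamma(\mathbf a+\mu)}{\Gamma(\mathbf b+\mu)}=\int_{\mathbb R}e^{-\mu t}g_0(t)\,dt\qquad\text{for all }\mu>0 .$$ Then, setting $g_n(t)=e^{-nt}g_0(t)$, one has $\Gamma(\mathbf a+\mu+n)/\Gamma(\mathbf b+\mu+n)=\int_{\mathbb R}e^{-\mu t}g_n(t)\,dt$ for every $n\in\mathbb N_0$ and $\mu>0$. Moreover, for every $x\ge0$ in the convergence domain (i.e. such that the series defining $f(\mu;x)$ converges for every $\mu>0$), the function $\mu\mapsto f(\mu;x)$ is log-convex on $(0,\infty)$, so $$\Delta_f(\mu;\alpha,\beta;x):=f(\mu+\alpha;x)f(\mu+\beta;x)-f(\mu;x)f(\mu+\alpha+\beta;x)\le0$$ for all $\mu>0$ and $\alpha,\beta\ge0$.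
   Context: For vectors $\mathbf a=(a_1,\dots,a_p)$, $\mathbf b=(b_1,\dots,b_q)$ write $\Gamma(\mathbf a+z)=\prod_{i=1}^p\Gamma(a_i+z)$ and $\Gamma(\mathbf b+z)=\prod_{j=1}^q\Gamma(b_j+z)$. The function $f$ is $$f(\mu;x)=\sum_{n\ge0}\frac{\Gamma(\mathbf a+\mu+n)}{\Gamma(\mathbf b+\mu+n)}\,\frac{x^n}{n!}.$$ *)

theory Defs
  imports "HOL-Analysis.Analysis"
begin

definition Gamma_vec :: "real list \<Rightarrow> real \<Rightarrow> real" where
  "Gamma_vec c z = (\<Prod>i<length c. Gamma (c ! i + z))"

definition gamma_ratio :: "real list \<Rightarrow> real list \<Rightarrow> real \<Rightarrow> real" where
  "gamma_ratio a b z = Gamma_vec a z / Gamma_vec b z"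

definition gamma_series_term :: "real list \<Rightarrow> real list \<Rightarrow> real \<Rightarrow> real \<Rightarrow> nat \<Rightarrow> real" where
  "gamma_series_term a b \<mu> x n = gamma_ratio a b (\<mu> + real n) * (x ^ n / fact n)"

definition gamma_series :: "real list \<Rightarrow> real list \<Rightarrow> real \<Rightarrow> real \<Rightarrow> real" where
  "gamma_series a b \<mu> x = (\<Sum>n. gamma_series_term a b \<mu> x n)"

text \<open>Positivity is part of the definition because \<open>ln\<close> also takes values outside the positive reals.\<close>

definition log_convex_on :: "real set \<Rightarrow> (real \<Rightarrow> real) \<Rightarrow> bool" where
  "log_convex_on S h \<longleftrightarrow> (\<forall>u\<in>S. 0 < h u) \<and> convex_on S (\<lambda>u. ln (h u))"

definition Turan_diff ::
  "(real \<Rightarrow> real \<Rightarrow> real) \<Rightarrow> real \<Rightarrow> real \<Rightarrow> real \<Rightarrow> real \<Rightarrow> real" where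
  "Turan_diff f \<mu> \<alpha> \<beta> x = f (\<mu> + \<alpha>) x * f (\<mu> + \<beta>) x - f \<mu> x * f (\<mu> + \<alpha> + \<beta>) x"

end

theory Submission imports Defs
begin

text \<open>
  Log-convexity says that \<open>h ((1 - s) u + s v) \<le> h u powr (1 - s) * h v powr s\<close>, and by Hoelder's
  inequality this bound survives integration over a parameter. That principle is used twice, for
  two different measures. For Lebesgue measure it shows that a Laplace transform of a nonnegative
  function is log-convex, since \<open>\<mu> \<mapsto> exp (- \<mu> t)\<close> is even log-affine for each \<open>t\<close>; hence the
  gamma ratio is log-convex. For the counting measure on the naturals it shows that the series,
  whose terms are shifts of the gamma ratio with nonnegative weights, is log-convex as well.

  Multiplying the integrand by \<open>exp (- n t)\<close> only shifts the argument of the Laplace transform,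
  which gives the integral representations of the shifted ratios. The inequality for the
  Turan difference is the log-convexity bound at the two points \<open>\<mu> + \<alpha>\<close> and \<open>\<mu> + \<beta>\<close>, which
  divide the interval from \<open>\<mu>\<close> to \<open>\<mu> + \<alpha> + \<beta>\<close> in complementary ratios.
\<close>

section \<open>Log-convex functions\<close>

lemma log_convex_on_powrI:
  assumes "convex S"
    and pos: "\<And>u. u \<in> S \<Longrightarrow> 0 < h u"
    and le: "\<And>s u v. \<lbrakk>0 < s; s < 1; u \<in> S; v \<in> S\<rbrakk> \<Longrightarrow>
      h ((1 - s) * u + s * v) \<le> h u powr (1 - s) * h v powr s"
  shows "log_convex_on S h"
  unfolding log_convex_on_def
proof (intro conjI ballI pos convex_onI)
  fix s u v :: real
  assume s: "0 < s" "s < 1" and uv: "u \<in> S" "v \<in> S"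
  have "(1 - s) * u + s * v \<in> S"
    using convexD_alt[OF \<open>convex S\<close> uv, of s] s by simp
  then have "ln (h ((1 - s) * u + s * v)) \<le> ln (h u powr (1 - s) * h v powr s)"
    using pos le[OF s uv] by (intro ln_mono) auto
  also have "\<dots> = (1 - s) * ln (h u) + s * ln (h v)"
    using pos[OF uv(1)] pos[OF uv(2)] by (simp add: ln_mult ln_powr)
  finally show "ln (h ((1 - s) *\<^sub>R u + s *\<^sub>R v)) \<le> (1 - s) * ln (h u) + s * ln (h v)"
    by simp
qed (use assms in auto)

lemma log_convex_on_powrD:
  assumes h: "log_convex_on S h" and "convex S"
    and s: "0 < s" "s < 1" and uv: "u \<in> S" "v \<in> S"
  shows "h ((1 - s) * u + s * v) \<le> h u powr (1 - s) * h v powr s"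
proof -
  have pos: "0 < h u" "0 < h v" and conv: "convex_on S (\<lambda>u. ln (h u))"
    using h uv by (auto simp: log_convex_on_def)
  have "(1 - s) * u + s * v \<in> S"
    using convexD_alt[OF \<open>convex S\<close> uv, of s] s by simp
  then have w: "0 < h ((1 - s) * u + s * v)"
    using h by (auto simp: log_convex_on_def)
  have "ln (h ((1 - s) * u + s * v)) \<le> (1 - s) * ln (h u) + s * ln (h v)"
    using convex_onD[OF conv _ _ uv, of s] s by simp
  also have "\<dots> = ln (h u powr (1 - s) * h v powr s)"
    using pos by (simp add: ln_mult ln_powr)
  finally show ?thesis
    using w pos by simp
qed

text \<open>
  The inner points are convex combinations of the end points with weights \<open>\<alpha> / (\<alpha> + \<beta>)\<close> and
  \<open>\<beta> / (\<alpha> + \<beta>)\<close>. These weights add up to one, so when the two convexity bounds are added, each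
  end point is counted exactly once.
\<close>

lemma log_convex_on_mult_le:
  assumes h: "log_convex_on S h"
    and S: "\<mu> \<in> S" "\<mu> + \<alpha> + \<beta> \<in> S" "convex S" and nonneg: "0 \<le> \<alpha>" "0 \<le> \<beta>"
  shows "h (\<mu> + \<alpha>) * h (\<mu> + \<beta>) \<le> h \<mu> * h (\<mu> + \<alpha> + \<beta>)"
proof (cases "\<alpha> = 0 \<or> \<beta> = 0")
  case True
  then show ?thesis by auto
next
  case False
  then have ab: "0 < \<alpha>" "0 < \<beta>" using nonneg by auto
  define s where "s = \<alpha> / (\<alpha> + \<beta>)"
  have s: "0 < s" "s < 1" and s': "0 < 1 - s" "1 - s < 1"
    using ab by (auto simp: s_def)
  have pos: "0 < h \<mu>" "0 < h (\<mu> + \<alpha> + \<beta>)"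
    using h S by (auto simp: log_convex_on_def)
  have sab: "s * (\<alpha> + \<beta>) = \<alpha>" using ab by (simp add: s_def)
  have eq1: "(1 - s) * \<mu> + s * (\<mu> + \<alpha> + \<beta>) = \<mu> + \<alpha>"
    using sab by (simp add: algebra_simps)
  have eq2: "s * \<mu> + (1 - s) * (\<mu> + \<alpha> + \<beta>) = \<mu> + \<beta>"
    using sab by (simp add: algebra_simps)
  have "\<mu> + \<alpha> \<in> S" "\<mu> + \<beta> \<in> S"
    using convexD_alt[OF S(3,1,2), of s] convexD_alt[OF S(3,1,2), of "1 - s"] s eq1 eq2 by auto
  then have mid: "0 < h (\<mu> + \<alpha>)" "0 < h (\<mu> + \<beta>)"
    using h by (auto simp: log_convex_on_def)
  have le1: "h (\<mu> + \<alpha>) \<le> h \<mu> powr (1 - s) * h (\<mu> + \<alpha> + \<beta>) powr s"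
    using log_convex_on_powrD[OF h S(3) s S(1,2)] eq1 by simp
  have le2: "h (\<mu> + \<beta>) \<le> h \<mu> powr s * h (\<mu> + \<alpha> + \<beta>) powr (1 - s)"
    using log_convex_on_powrD[OF h S(3) s' S(1,2)] eq2 by simp
  have "h (\<mu> + \<alpha>) * h (\<mu> + \<beta>) \<le>
      (h \<mu> powr (1 - s) * h (\<mu> + \<alpha> + \<beta>) powr s) * (h \<mu> powr s * h (\<mu> + \<alpha> + \<beta>) powr (1 - s))"
    using le1 le2 mid by (intro mult_mono) auto
  also have "\<dots> = (h \<mu> powr (1 - s) * h \<mu> powr s) *
      (h (\<mu> + \<alpha> + \<beta>) powr s * h (\<mu> + \<alpha> + \<beta>) powr (1 - s))"
    by (simp only: mult_ac)
  also have "\<dots> = h \<mu> * h (\<mu> + \<alpha> + \<beta>)"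
    using pos by (simp flip: powr_add)
  finally show ?thesis .
qed

section \<open>Integrals of log-convex families\<close>

text \<open>
  This is Hoelder's inequality in disguise. Once both end point functions are normalised to have
  integral one, Young's inequality bounds the integrand pointwise by their weighted mean, whose
  integral is one. The hypothesis uses the power form of log-convexity instead of
  \<^const>\<open>log_convex_on\<close> because the integrand may vanish for some parameters.
\<close>

lemma log_convex_on_integral:
  fixes F :: "real \<Rightarrow> 'a \<Rightarrow> real" and H :: "real \<Rightarrow> real"
  assumes "convex S"
    and H: "\<And>u. u \<in> S \<Longrightarrow> has_bochner_integral M (F u) (H u)"
    and nonneg: "\<And>u t. u \<in> S \<Longrightarrow> 0 \<le> F u t"
    and pos: "\<And>u. u \<in> S \<Longrightarrow> 0 < H u"
    and le: "\<And>s u v t. \<lbrakk>0 < s; s < 1; u \<in> S; v \<in> S\<rbrakk> \<Longrightarrow>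
      F ((1 - s) * u + s * v) t \<le> F u t powr (1 - s) * F v t powr s"
  shows "log_convex_on S H"
proof (rule log_convex_on_powrI[OF \<open>convex S\<close> pos])
  fix s u v :: real
  assume s: "0 < s" "s < 1" and uv: "u \<in> S" "v \<in> S"
  define A B C where "A = H u" and "B = H v"
    and "C = A powr (1 - s) * B powr s"
  have A: "0 < A" and B: "0 < B" using pos uv by (auto simp: A_def B_def)
  then have C: "0 < C" by (simp add: C_def)
  have w: "(1 - s) * u + s * v \<in> S"
    using convexD_alt[OF \<open>convex S\<close> uv, of s] s by simp
  have young: "F ((1 - s) * u + s * v) t \<le> C * ((1 - s) * (F u t / A) + s * (F v t / B))" for t
  proof -
    have "F ((1 - s) * u + s * v) t \<le> F u t powr (1 - s) * F v t powr s"
      by (rule le[OF s uv])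
    also have "\<dots> = C * ((F u t / A) powr (1 - s) * (F v t / B) powr s)"
      using A B nonneg uv by (simp add: C_def powr_divide)
    also have "(F u t / A) powr (1 - s) * (F v t / B) powr s \<le>
        (1 - s) * (F u t / A) + s * (F v t / B)"
    proof (cases "F u t = 0 \<or> F v t = 0")
      case True
      then show ?thesis using A B s nonneg uv by auto
    next
      case False
      then have "0 < F u t" "0 < F v t"
        using nonneg[of u t] nonneg[of v t] uv by auto
      then show ?thesis
        using A B s by (intro Youngs_inequality_0) auto
    qed
    finally show ?thesis using C by simp
  qed
  have int: "integrable M (F u)" "integrable M (F v)" "integrable M (F ((1 - s) * u + s * v))"
    and eq: "H u = integral\<^sup>L M (F u)" "H v = integral\<^sup>L M (F v)"
      "H ((1 - s) * u + s * v) = integral\<^sup>L M (F ((1 - s) * u + s * v))"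
    using H uv w by (auto simp: has_bochner_integral_iff)
  have "H ((1 - s) * u + s * v) \<le> (\<integral>t. C * ((1 - s) * (F u t / A) + s * (F v t / B)) \<partial>M)"
    unfolding eq using int by (intro integral_mono young) auto
  also have "\<dots> = C * ((1 - s) * (A / A) + s * (B / B))"
    using int by (simp add: A_def B_def eq)
  also have "\<dots> = C" using A B by simp
  finally show "H ((1 - s) * u + s * v) \<le> H u powr (1 - s) * H v powr s"
    by (simp add: A_def B_def C_def)
qed

lemma log_convex_on_Laplace_transform:
  fixes g L :: "real \<Rightarrow> real"
  assumes "convex S" and nonneg: "\<And>t. 0 \<le> g t"
    and L: "\<And>\<mu>. \<mu> \<in> S \<Longrightarrow> has_bochner_integral M (\<lambda>t. exp (- \<mu> * t) * g t) (L \<mu>)"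
    and pos: "\<And>\<mu>. \<mu> \<in> S \<Longrightarrow> 0 < L \<mu>"
  shows "log_convex_on S L"
proof (rule log_convex_on_integral[OF \<open>convex S\<close> L])
  fix s u v t :: real
  have "(exp (- u * t) * g t) powr (1 - s) * (exp (- v * t) * g t) powr s =
      (exp (- u * t) powr (1 - s) * exp (- v * t) powr s) * (g t powr (1 - s) * g t powr s)"
    using nonneg by (simp add: powr_mult)
  also have "exp (- u * t) powr (1 - s) * exp (- v * t) powr s =
      exp (- ((1 - s) * u + s * v) * t)"
    by (simp add: exp_powr_real algebra_simps flip: exp_add)
  also have "g t powr (1 - s) * g t powr s = g t"
    using nonneg[of t] by (simp flip: powr_add)
  finally show "exp (- ((1 - s) * u + s * v) * t) * g t \<le>
      (exp (- u * t) * g t) powr (1 - s) * (exp (- v * t) * g t) powr s"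
    by simp
qed (use nonneg pos in auto)

text \<open>
  The weights may vanish, but not the first one, which makes the sum positive. Since \<open>0 ^ 0 = 1\<close>,
  the power series weights satisfy this even at the origin.
\<close>

lemma log_convex_on_weighted_shift_series:
  fixes h :: "real \<Rightarrow> real" and c :: "nat \<Rightarrow> real"
  assumes h: "log_convex_on {0<..} h"
    and c: "\<And>n. 0 \<le> c n" "0 < c 0"
    and summable: "\<And>\<mu>. 0 < \<mu> \<Longrightarrow> summable (\<lambda>n. h (\<mu> + real n) * c n)"
  shows "log_convex_on {0<..} (\<lambda>\<mu>. \<Sum>n. h (\<mu> + real n) * c n)"
proof -
  let ?F = "\<lambda>\<mu> n. h (\<mu> + real n) * c n"
  have hpos: "0 < h (\<mu> + real n)" if "0 < \<mu>" for \<mu> n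
    using h that by (auto simp: log_convex_on_def)
  have nonneg: "0 \<le> ?F \<mu> n" if "0 < \<mu>" for \<mu> n
    using hpos[OF that, of n] c(1)[of n] by simp
  show ?thesis
  proof (rule log_convex_on_integral)
    fix \<mu> :: real assume "\<mu> \<in> {0<..}"
    then have \<mu>: "0 < \<mu>" by simp
    have "integrable (count_space UNIV) (?F \<mu>)"
      using summable[OF \<mu>] nonneg[OF \<mu>] by (simp add: integrable_count_space_nat_iff)
    then show "has_bochner_integral (count_space UNIV) (?F \<mu>) (suminf (?F \<mu>))"
      by (simp add: has_bochner_integral_iff integral_count_space_nat)
    show "0 < suminf (?F \<mu>)"
      using summable[OF \<mu>] nonneg[OF \<mu>]
    proof (rule suminf_pos2)
      show "0 < ?F \<mu> 0" using hpos[OF \<mu>, of 0] c(2) by simp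
    qed
  next
    fix s u v :: real and n :: nat
    assume s: "0 < s" "s < 1" and "u \<in> {0<..}" "v \<in> {0<..}"
    then have uv: "0 < u" "0 < v" by auto
    have "h ((1 - s) * (u + real n) + s * (v + real n)) \<le>
        h (u + real n) powr (1 - s) * h (v + real n) powr s"
      using uv by (intro log_convex_on_powrD[OF h _ s]) auto
    moreover have "(1 - s) * (u + real n) + s * (v + real n) = (1 - s) * u + s * v + real n"
      by (simp add: algebra_simps)
    ultimately have "?F ((1 - s) * u + s * v) n \<le>
        h (u + real n) powr (1 - s) * h (v + real n) powr s * c n"
      using c(1)[of n] by (simp add: mult_right_mono)
    also have "\<dots> = h (u + real n) powr (1 - s) * h (v + real n) powr s *
        (c n powr (1 - s) * c n powr s)"
      using c(1)[of n] by (simp flip: powr_add)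
    also have "\<dots> = ?F u n powr (1 - s) * ?F v n powr s"
      using hpos[OF uv(1), of n] hpos[OF uv(2), of n] c(1)[of n] by (simp add: powr_mult)
    finally show "?F ((1 - s) * u + s * v) n \<le> ?F u n powr (1 - s) * ?F v n powr s" .
  qed (use nonneg in auto)
qed

section \<open>The gamma ratio series\<close>

lemma Gamma_vec_pos:
  assumes "\<forall>c\<in>set cs. 0 < c" and "0 < z"
  shows "0 < Gamma_vec cs z"
  unfolding Gamma_vec_def using assms by (intro prod_pos ballI Gamma_real_pos add_pos_pos) auto

theorem proposition3p7:
  fixes a b :: "real list" and g0 :: "real \<Rightarrow> real"
  assumes "length b \<le> length a"
    and "\<forall>c\<in>set a. 0 < c"
    and "\<forall>c\<in>set b. 0 < c"
    and "g0 \<in> borel_measurable lebesgue"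
    and "\<forall>t. 0 \<le> g0 t"
    and "\<forall>\<mu>>0. has_bochner_integral lebesgue (\<lambda>t. exp (- \<mu> * t) * g0 t) (gamma_ratio a b \<mu>)"
  defines "g \<equiv> (\<lambda>(n::nat) (t::real). exp (- real n * t) * g0 t)"
  shows "(\<forall>n. \<forall>\<mu>>0. has_bochner_integral lebesgue (\<lambda>t. exp (- \<mu> * t) * g n t)
            (gamma_ratio a b (\<mu> + real n))) \<and>
         (\<forall>x\<ge>0. (\<forall>\<mu>>0. summable (gamma_series_term a b \<mu> x)) \<longrightarrow>
            log_convex_on {0<..} (\<lambda>\<mu>. gamma_series a b \<mu> x) \<and>
            (\<forall>\<mu>>0. \<forall>\<alpha>\<ge>0. \<forall>\<beta>\<ge>0. Turan_diff (gamma_series a b) \<mu> \<alpha> \<beta> x \<le> 0))"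
proof (intro conjI allI impI)
  fix n :: nat and \<mu> :: real
  assume "0 < \<mu>"
  have "exp (- \<mu> * t) * g n t = exp (- (\<mu> + real n) * t) * g0 t" for t
    by (simp add: g_def algebra_simps flip: exp_add mult.assoc)
  moreover have "has_bochner_integral lebesgue (\<lambda>t. exp (- (\<mu> + real n) * t) * g0 t)
      (gamma_ratio a b (\<mu> + real n))"
    using \<open>0 < \<mu>\<close> by (intro assms(6)[rule_format] add_pos_nonneg) auto
  ultimately show "has_bochner_integral lebesgue (\<lambda>t. exp (- \<mu> * t) * g n t)
      (gamma_ratio a b (\<mu> + real n))"
    by simp
next
  have ratio: "log_convex_on {0<..} (gamma_ratio a b)"
  proof (rule log_convex_on_Laplace_transform[where g = g0 and M = lebesgue])
    show "0 < gamma_ratio a b \<mu>" if "\<mu> \<in> {0<..}" for \<mu>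
      using that assms(2,3) by (simp add: gamma_ratio_def Gamma_vec_pos)
  qed (use assms(5,6) in auto)
  fix x :: real
  assume x: "0 \<le> x" and summable: "\<forall>\<mu>>0. summable (gamma_series_term a b \<mu> x)"
  show series: "log_convex_on {0<..} (\<lambda>\<mu>. gamma_series a b \<mu> x)"
    unfolding gamma_series_def gamma_series_term_def
    using ratio x summable
    by (intro log_convex_on_weighted_shift_series) (auto simp: gamma_series_term_def[abs_def])
  fix \<mu> \<alpha> \<beta> :: real
  assume "0 < \<mu>" "0 \<le> \<alpha>" "0 \<le> \<beta>"
  then show "Turan_diff (gamma_series a b) \<mu> \<alpha> \<beta> x \<le> 0"
    using log_convex_on_mult_le[OF series, of \<mu> \<alpha> \<beta>] by (simp add: Turan_diff_def)
qed

end
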